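(* Let $N$ be a stationary point process on $\mathbb{R}$ whose reduced third factorial cumulant measure $\kappa_3^{\mathrm{red}}$ is well defined and has a density: $\kappa_3^{\mathrm{red}}(d\tau_1,d\tau_2)=c_3(\tau_1,\tau_2)\,d\tau_1d\tau_2$ with $c_3\in L^1(\mathbb{R}^2)$. Define the factorial bispectrum $$B_{\mathrm{fac}}(\omega_1,\omega_2):=\iint_{\mathbb{R}^2}c_3(\tau_1,\tau_2)e^{-\mathrm{i}(\omega_1\tau_1+\omega_2\tau_2)}\,d\tau_1d\tau_2 .$$ If $N$ is reversible, then $$c_3(\tau_1,\tau_2)=c_3(-\tau_1,-\tau_2)\quad\text{for a.e. }(\tau_1,\tau_2)\in\mathbb{R}^2,$$ and therefore $B_{\mathrm{fac}}(\omega_1,\omega_2)\in\mathbb{R}$ for all $(\omega_1,\omega_2)\in\mathbb{R}^2$.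
   Context: For a point process (random locally finite counting measure) $N$ on $\mathbb{R}$, let $(RN)(A):=N(-A)$ for Borel $A$; $N$ is reversible if $N\stackrel{d}{=}RN$. Factorial cumulant measures: for bounded compactly supported Borel $q$ with $1+q\ge 0$ let $G_{\mathrm{fac}}(q)=\mathbb{E}\prod_{x\in N}(1+q(x))$ and $K_{\mathrm{fac}}(q)=\log G_{\mathrm{fac}}(q)$ (when finite and positive). The $n$th factorial cumulant measure $\kappa_n$ on $\mathbb{R}^n$ is characterized by $$\int\prod_{j=0}^{n-1}f_j(t_j)\,\kappa_n(dt_0,\dots,dt_{n-1})=\partial_{s_0}\cdots\partial_{s_{n-1}}K_{\mathrm{fac}}\Big(\sum_{j}s_jf_j\Big)\Big|_{s=0}$$ for bounded compactly supported $f_j$, interpreted as a finite-order variational derivative at the origin (these are the standard factorial cumulant measures of point process theory). For stationary $N$ and $n\ge2$, the reduced measure $\kappa_n^{\mathrm{red}}$ on $\mathbb{R}^{n-1}$ is defined by $$\int_{\mathbb{R}^n}F\,d\kappa_n=\int_{\mathbb{R}}\int_{\mathbb{R}^{n-1}}F(t_0,t_0+\tau_1,\dots,t_0+\tau_{n-1})\,\kappa_n^{\mathrm{red}}(d\tau_1,\dots,d\tau_{n-1})\,dt_0 .$$ No powers of the intensity are factored out. *)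

theory Defs
  imports "HOL-Probability.Probability"
begin

section \<open>Point processes on the real line\<close>

text \<open>Multiple points are allowed: locally finite counting measures are the Borel measures
  that take natural-number values on bounded Borel sets.\<close>

definition counting_configs :: "real measure set" where
  "counting_configs =
     {\<mu>. sets \<mu> = sets borel \<and>
         (\<forall>A \<in> sets borel. bounded A \<longrightarrow> (\<exists>k::nat. emeasure \<mu> A = of_nat k))}"

text \<open>The sigma-algebra on configurations generated by the evaluation maps
  (built in the same way as \<^const>\<open>subprob_algebra\<close>).\<close>

definition config_algebra :: "real measure measure" where
  "config_algebra =
     (SUP A \<in> sets borel. vimage_algebra counting_configs (\<lambda>\<mu>. emeasure \<mu> A) borel)"

definition point_process :: "'w measure \<Rightarrow> ('w \<Rightarrow> real measure) \<Rightarrow> bool" where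
  "point_process M N \<longleftrightarrow> prob_space M \<and> N \<in> measurable M config_algebra"

definition law :: "'w measure \<Rightarrow> ('w \<Rightarrow> real measure) \<Rightarrow> real measure measure" where
  "law M N = distr M config_algebra N"

definition translate :: "real \<Rightarrow> real measure \<Rightarrow> real measure" where
  "translate t \<mu> = distr \<mu> borel (\<lambda>x. x + t)"

definition reflect :: "real measure \<Rightarrow> real measure" where
  "reflect \<mu> = distr \<mu> borel uminus"

definition stationary :: "'w measure \<Rightarrow> ('w \<Rightarrow> real measure) \<Rightarrow> bool" where
  "stationary M N \<longleftrightarrow> (\<forall>t. law M (\<lambda>w. translate t (N w)) = law M N)"

definition reversible :: "'w measure \<Rightarrow> ('w \<Rightarrow> real measure) \<Rightarrow> bool" where
  "reversible M N \<longleftrightarrow> law M N = law M (\<lambda>w. reflect (N w))"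


section \<open>The factorial generating functionals\<close>

text \<open>The product over the points of \<open>\<mu>\<close>, counted with multiplicity. Points with \<open>q x = 0\<close>
  contribute the factor 1; leaving them out makes the index set finite when \<open>q\<close> is compactly
  supported.\<close>

definition point_prod :: "real measure \<Rightarrow> (real \<Rightarrow> real) \<Rightarrow> real" where
  "point_prod \<mu> q =
     (\<Prod>x \<in> {x. measure \<mu> {x} \<noteq> 0 \<and> q x \<noteq> 0}. (1 + q x) ^ nat \<lfloor>measure \<mu> {x}\<rfloor>)"

text \<open>For \<open>1 + q \<ge> 0\<close> the integrand is nonnegative, and the value may be \<open>\<infinity>\<close>.\<close>

definition G_fac :: "'w measure \<Rightarrow> ('w \<Rightarrow> real measure) \<Rightarrow> (real \<Rightarrow> real) \<Rightarrow> ennreal" where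
  "G_fac M N q = (\<integral>\<^sup>+ w. ennreal (point_prod (N w) q) \<partial>M)"

text \<open>Meaningful only where \<^term>\<open>G_fac M N q\<close> is finite and positive. This always holds for
  compactly supported \<open>q\<close> with \<open>-1 < q \<le> 0\<close>, the only arguments that matter below.\<close>

definition K_fac :: "'w measure \<Rightarrow> ('w \<Rightarrow> real measure) \<Rightarrow> (real \<Rightarrow> real) \<Rightarrow> real" where
  "K_fac M N q = ln (enn2real (G_fac M N q))"

definition test_function :: "(real \<Rightarrow> real) \<Rightarrow> bool" where
  "test_function f \<longleftrightarrow> f \<in> borel_measurable borel \<and> bounded (range f) \<and> bounded {x. f x \<noteq> 0}"


section \<open>Signed measures on a finite power of the real line\<close>

text \<open>Factorial cumulant measures are in general signed, with infinite positive and negative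
  parts. A locally finite signed measure on the power with finite index set \<open>I\<close> is given by a
  pair \<open>(P, Q)\<close> of locally finite measures, read as the difference \<open>P - Q\<close>. The pair is not
  unique, and everything below depends on the difference only.\<close>

type_synonym signed_measure = "(nat \<Rightarrow> real) measure \<times> (nat \<Rightarrow> real) measure"

definition locally_finite_on :: "nat set \<Rightarrow> (nat \<Rightarrow> real) measure \<Rightarrow> bool" where
  "locally_finite_on I P \<longleftrightarrow>
     sets P = sets (\<Pi>\<^sub>M i\<in>I. borel) \<and> (\<forall>r. emeasure P (\<Pi>\<^sub>E i\<in>I. {-r..r}) < \<infinity>)"

definition signed_measure_on :: "nat set \<Rightarrow> signed_measure \<Rightarrow> bool" where
  "signed_measure_on I \<kappa> \<longleftrightarrow> locally_finite_on I (fst \<kappa>) \<and> locally_finite_on I (snd \<kappa>)"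

definition signed_integral :: "signed_measure \<Rightarrow> ((nat \<Rightarrow> real) \<Rightarrow> real) \<Rightarrow> real" where
  "signed_integral \<kappa> F = (\<integral>t. F t \<partial>fst \<kappa>) - (\<integral>t. F t \<partial>snd \<kappa>)"

definition test_function_on :: "nat set \<Rightarrow> ((nat \<Rightarrow> real) \<Rightarrow> real) \<Rightarrow> bool" where
  "test_function_on I F \<longleftrightarrow>
     F \<in> borel_measurable (\<Pi>\<^sub>M i\<in>I. borel) \<and>
     (\<exists>C r. \<forall>t \<in> (\<Pi>\<^sub>E i\<in>I. UNIV). \<bar>F t\<bar> \<le> C \<and> (F t \<noteq> 0 \<longrightarrow> (\<forall>i\<in>I. \<bar>t i\<bar> \<le> r)))"


section \<open>Factorial cumulant measures\<close>

text \<open>\<open>has_mixed_deriv n \<Phi> D\<close>: the iterated partial derivative of \<open>\<Phi>\<close> with respect to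
  \<open>s\<^sub>n\<^sub>-\<^sub>1\<close>, then \<open>s\<^sub>n\<^sub>-\<^sub>2\<close>, down to \<open>s\<^sub>0\<close>, exists at the origin and equals \<open>D\<close>. All derivatives are
  taken from below, and \<open>\<Phi>\<close> matters only where all \<open>s\<^sub>i\<close> are nonpositive and close to 0.\<close>

primrec has_mixed_deriv :: "nat \<Rightarrow> ((nat \<Rightarrow> real) \<Rightarrow> real) \<Rightarrow> real \<Rightarrow> bool" where
  "has_mixed_deriv 0 \<Phi> D \<longleftrightarrow> \<Phi> (\<lambda>_. 0) = D"
| "has_mixed_deriv (Suc n) \<Phi> D \<longleftrightarrow>
     (\<exists>\<Psi>. (\<exists>\<delta>>0. \<forall>s. (\<forall>i<n. s i \<in> {-\<delta><..0}) \<longrightarrow>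
                ((\<lambda>x. \<Phi> (s(n := x))) has_real_derivative \<Psi> s) (at_left 0)) \<and>
          has_mixed_deriv n \<Psi> D)"

text \<open>The variational derivative at the origin is taken along the directions in which \<open>K_fac\<close> is
  always defined: for \<open>f\<^sub>j \<ge> 0\<close> and \<open>s\<^sub>j \<le> 0\<close> near 0 the argument \<open>q = \<Sum>\<^sub>j s\<^sub>j f\<^sub>j\<close> satisfies
  \<open>-1 < q \<le> 0\<close>, so \<open>0 < G_fac q \<le> 1\<close>. For \<open>q\<close> with positive values, finiteness of \<open>G_fac q\<close> would
  require exponential moments, whereas the factorial cumulant measure of order \<open>n\<close> needs only
  moments of order \<open>n\<close>. If \<open>K_fac\<close> does have the two-sided derivatives, they coincide
  with those used here. The formula for \<open>f\<^sub>j\<close> of varying sign follows by multilinearity from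
  \<open>f\<^sub>j = f\<^sub>j\<^sup>+ - f\<^sub>j\<^sup>-\<close>, and \<open>\<kappa>\<close> is determined by its values on products of nonnegative functions.\<close>

definition factorial_cumulant_measure ::
    "'w measure \<Rightarrow> ('w \<Rightarrow> real measure) \<Rightarrow> nat \<Rightarrow> signed_measure \<Rightarrow> bool" where
  "factorial_cumulant_measure M N n \<kappa> \<longleftrightarrow>
     signed_measure_on {..<n} \<kappa> \<and>
     (\<forall>f. (\<forall>j<n. test_function (f j) \<and> (\<forall>x. 0 \<le> f j x)) \<longrightarrow>
        has_mixed_deriv n (\<lambda>s. K_fac M N (\<lambda>x. \<Sum>j<n. s j * f j x))
          (signed_integral \<kappa> (\<lambda>t. \<Prod>j<n. f j (t j))))"

text \<open>The map \<open>(t\<^sub>0, \<tau>) \<mapsto> (t\<^sub>0, t\<^sub>0 + \<tau>\<^sub>1, \<dots>, t\<^sub>0 + \<tau>\<^sub>n\<^sub>-\<^sub>1)\<close>, where the lags \<open>\<tau>\<close> are indexed by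
  \<open>{1..<n}\<close>.\<close>

definition from_lags :: "nat \<Rightarrow> real \<Rightarrow> (nat \<Rightarrow> real) \<Rightarrow> (nat \<Rightarrow> real)" where
  "from_lags n t \<tau> = (\<lambda>i\<in>{..<n}. if i = 0 then t else t + \<tau> i)"

definition reduced_measure :: "nat \<Rightarrow> signed_measure \<Rightarrow> signed_measure \<Rightarrow> bool" where
  "reduced_measure n \<kappa> \<kappa>red \<longleftrightarrow>
     signed_measure_on {1..<n} \<kappa>red \<and>
     (\<forall>F. test_function_on {..<n} F \<longrightarrow>
        signed_integral \<kappa> F =
          (\<integral>t. signed_integral \<kappa>red (\<lambda>\<tau>. F (from_lags n t \<tau>)) \<partial>lborel))"

text \<open>\<open>\<kappa>red(d\<tau>\<^sub>1, d\<tau>\<^sub>2) = c(\<tau>\<^sub>1, \<tau>\<^sub>2) d\<tau>\<^sub>1 d\<tau>\<^sub>2\<close>, tested on bounded sets because both parts of the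
  pair representing \<open>\<kappa>red\<close> may be infinite.\<close>

definition has_lag_density :: "signed_measure \<Rightarrow> (real \<times> real \<Rightarrow> real) \<Rightarrow> bool" where
  "has_lag_density \<kappa>red c \<longleftrightarrow>
     (\<forall>A \<in> sets borel. bounded A \<longrightarrow>
        signed_integral \<kappa>red (\<lambda>\<tau>. indicator A (\<tau> 1, \<tau> 2)) = (LINT p:A|lborel. c p))"

definition B_fac :: "(real \<times> real \<Rightarrow> real) \<Rightarrow> real \<Rightarrow> real \<Rightarrow> complex" where
  "B_fac c \<omega>1 \<omega>2 =
     (LINT (\<tau>1, \<tau>2)|lborel.
        complex_of_real (c (\<tau>1, \<tau>2)) * exp (- (\<i> * complex_of_real (\<omega>1 * \<tau>1 + \<omega>2 * \<tau>2))))"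

end

theory Submission
  imports Defs
begin

text \<open>For \<open>-1 < q \<le> 0\<close> the product over the points of a configuration \<open>\<mu>\<close> equals
  \<open>exp (\<integral> ln (1 + q) d\<mu>)\<close>, hence is measurable on configurations, and reversibility gives
  \<open>G_fac q = G_fac (q \<circ> uminus)\<close>. Uniqueness of the mixed derivatives makes the cumulant measure
  invariant under reflection when tested on products, and by a Dynkin argument when tested on all
  bounded measurable sets. The set \<open>{t\<^sub>0 \<in> [0,1], (t\<^sub>1 - t\<^sub>0, t\<^sub>2 - t\<^sub>0) \<in> A}\<close> then yields
  \<open>\<integral>\<^bsub>A\<^esub> c\<^sub>3 = \<integral>\<^bsub>-A\<^esub> c\<^sub>3\<close> for every bounded Borel set \<open>A\<close>.\<close>

section \<open>Measurability on the space of configurations\<close>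

lemma space_config_algebra [simp]: "space config_algebra = counting_configs"
  by (auto simp: config_algebra_def space_Sup_eq_UN)

lemma sets_counting_configs: "\<mu> \<in> counting_configs \<Longrightarrow> sets \<mu> = sets borel"
  by (simp add: counting_configs_def)

lemma measurable_emeasure_config_algebra:
  "A \<in> sets borel \<Longrightarrow> (\<lambda>\<mu>. emeasure \<mu> A) \<in> borel_measurable config_algebra"
  by (auto intro!: measurable_Sup1 measurable_vimage_algebra1 simp: config_algebra_def)

lemma measurable_config_algebraI:
  assumes "\<And>w. w \<in> space M \<Longrightarrow> N w \<in> counting_configs"
    and "\<And>A. A \<in> sets borel \<Longrightarrow> (\<lambda>w. emeasure (N w) A) \<in> borel_measurable M"
  shows "N \<in> measurable M config_algebra"
  using assms by (auto intro!: measurable_Sup2 measurable_vimage_algebra2 simp: config_algebra_def)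

text \<open>Induction over nonnegative Borel functions: indicators give the evaluation maps, and the
  other cases follow from linearity and monotone convergence of the integral. These integral
  identities are available only for \<mu> in \<open>counting_configs\<close>, whose sigma-algebra is
  the Borel one, so each case passes through \<open>measurable_cong\<close>.\<close>

lemma nn_integral_measurable_config_algebra:
  assumes f: "f \<in> borel_measurable borel"
  shows "(\<lambda>\<mu>. integral\<^sup>N \<mu> f) \<in> borel_measurable config_algebra" (is "_ \<in> ?B")
proof -
  have meas: "g \<in> borel_measurable \<mu>"
    if "\<mu> \<in> counting_configs" "g \<in> borel_measurable borel" for \<mu> and g :: "real \<Rightarrow> ennreal"
    using that by (simp add: counting_configs_def cong: measurable_cong_sets)
  show ?thesis
    using f
  proof induct
    case (cong f g)
    then have "f = g" by auto
    with cong show ?case by simp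
  next
    case (set A)
    then have "(\<lambda>\<mu>. \<integral>\<^sup>+x. indicator A x \<partial>\<mu>) \<in> ?B \<longleftrightarrow> (\<lambda>\<mu>. emeasure \<mu> A) \<in> ?B"
      by (intro measurable_cong nn_integral_indicator) (simp add: counting_configs_def)
    with set show ?case by (simp add: measurable_emeasure_config_algebra)
  next
    case (mult f c)
    then have "(\<lambda>\<mu>. \<integral>\<^sup>+x. c * f x \<partial>\<mu>) \<in> ?B \<longleftrightarrow> (\<lambda>\<mu>. c * \<integral>\<^sup>+x. f x \<partial>\<mu>) \<in> ?B"
      by (intro measurable_cong nn_integral_cmult) (auto intro: meas)
    with mult show ?case by simp
  next
    case (add f g)
    then have "(\<lambda>\<mu>. \<integral>\<^sup>+x. f x + g x \<partial>\<mu>) \<in> ?B \<longleftrightarrow>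
        (\<lambda>\<mu>. (\<integral>\<^sup>+x. f x \<partial>\<mu>) + (\<integral>\<^sup>+x. g x \<partial>\<mu>)) \<in> ?B"
      by (intro measurable_cong nn_integral_add) (auto intro: meas)
    with add show ?case by (simp add: ac_simps)
  next
    case (seq F)
    then have "(\<lambda>\<mu>. \<integral>\<^sup>+x. (SUP i. F i) x \<partial>\<mu>) \<in> ?B \<longleftrightarrow>
        (\<lambda>\<mu>. SUP i. (\<integral>\<^sup>+x. F i x \<partial>\<mu>)) \<in> ?B"
      unfolding SUP_apply
      by (intro measurable_cong nn_integral_monotone_convergence_SUP) (auto intro: meas)
    with seq show ?case by (simp add: ac_simps)
  qed
qed

section \<open>Reflection of configurations\<close>

lemma uminus_image_eq_vimage:
  fixes A :: "'a::group_add set"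
  shows "uminus ` A = uminus -` A"
proof (rule set_eqI)
  show "x \<in> uminus ` A \<longleftrightarrow> x \<in> uminus -` A" for x
    using image_eqI[of x uminus "- x" A] by auto
qed

lemma emeasure_reflect:
  assumes "sets \<mu> = sets borel" and "A \<in> sets borel"
  shows "emeasure (reflect \<mu>) A = emeasure \<mu> (uminus -` A)"
  using assms by (simp add: reflect_def emeasure_distr sets_eq_imp_space_eq[of \<mu> borel]
      measurable_cong_sets[of \<mu> borel])

lemma reflect_counting_configs:
  assumes "\<mu> \<in> counting_configs" shows "reflect \<mu> \<in> counting_configs"
proof -
  have "\<exists>k::nat. emeasure (reflect \<mu>) A = of_nat k" if "A \<in> sets borel" "bounded A" for A
  proof -
    have "uminus ` A \<in> sets borel"
      using measurable_sets_borel[of uminus borel A] that by (simp add: uminus_image_eq_vimage)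
    moreover have "bounded (uminus ` A)"
      using that by simp
    ultimately show ?thesis
      using assms that
      by (simp add: counting_configs_def emeasure_reflect uminus_image_eq_vimage[symmetric])
  qed
  then show ?thesis by (simp add: counting_configs_def reflect_def)
qed

lemma measurable_reflect: "reflect \<in> measurable config_algebra config_algebra"
proof (rule measurable_config_algebraI)
  fix A :: "real set" assume A: "A \<in> sets borel"
  then have "uminus -` A \<in> sets borel"
    by (intro measurable_sets_borel[of uminus]) auto
  then show "(\<lambda>\<mu>. emeasure (reflect \<mu>) A) \<in> borel_measurable config_algebra"
    by (subst measurable_cong[OF emeasure_reflect])
       (auto simp: A sets_counting_configs measurable_emeasure_config_algebra)
qed (simp add: reflect_counting_configs)

section \<open>Atomic structure of configurations and the exponential form of point products\<close>

text \<open>The punctured balls of radius \<open>1 / Suc n\<close> decrease to the empty set, so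
  their finite masses tend to 0. Being natural numbers, the masses vanish as soon as they drop below
  1.\<close>

lemma counting_config_isolated:
  assumes \<mu>: "\<mu> \<in> counting_configs"
  obtains e where "e > 0" "emeasure \<mu> (ball x e - {x}) = 0"
proof -
  define U where "U n = ball x (1 / Suc n) - {x}" for n
  have nat_valued: "\<exists>k::nat. emeasure \<mu> (U n) = of_nat k" for n
  proof -
    have "bounded (U n)" "U n \<in> sets borel"
      by (auto simp: U_def intro: bounded_subset[OF bounded_ball])
    then show ?thesis using \<mu> by (simp add: counting_configs_def)
  qed
  have "(\<lambda>n. emeasure \<mu> (U n)) \<longlonglongrightarrow> emeasure \<mu> (\<Inter>n. U n)"
  proof (rule Lim_emeasure_decseq)
    show "range U \<subseteq> sets \<mu>"
      by (auto simp: U_def sets_counting_configs[OF \<mu>])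
    have "ball x (1 / Suc n) \<subseteq> ball x (1 / Suc m)" if "m \<le> n" for m n
      using that by (intro subset_ball) (simp add: field_simps)
    then show "decseq U"
      unfolding decseq_def U_def by blast
    show "emeasure \<mu> (U n) \<noteq> \<infinity>" for n
      using nat_valued[of n] by auto
  qed
  moreover have "(\<Inter>n. U n) = {}"
  proof -
    have "y \<notin> (\<Inter>n. U n)" for y
    proof (cases "y = x")
      case False
      then obtain n where "1 / Suc n < dist x y"
        using nat_approx_posE[of "dist x y"] by auto
      then have "y \<notin> U n" by (simp add: U_def)
      then show ?thesis by blast
    qed (simp add: U_def)
    then show ?thesis by blast
  qed
  ultimately have "(\<lambda>n. emeasure \<mu> (U n)) \<longlonglongrightarrow> 0" by simp
  then have "eventually (\<lambda>n. emeasure \<mu> (U n) < 1) sequentially"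
    by (rule order_tendstoD) simp
  then obtain n where "emeasure \<mu> (U n) < 1"
    by (auto simp: eventually_sequentially)
  moreover obtain k :: nat where "emeasure \<mu> (U n) = of_nat k"
    using nat_valued by blast
  ultimately have "emeasure \<mu> (U n) = 0"
    by (cases k) (auto simp: not_less[symmetric])
  then show thesis
    by (intro that[of "1 / Suc n"]) (auto simp: U_def)
qed

text \<open>By compactness finitely many of the isolating balls cover the interval. Outside the set
  \<open>F\<close> of their centres, the interval lies in a finite union of punctured null balls.
  Centres without mass may belong to \<open>F\<close>.\<close>

lemma counting_config_atomic:
  assumes \<mu>: "\<mu> \<in> counting_configs"
  obtains F where "finite F" "emeasure \<mu> ({-r..r} - F) = 0"
proof -
  obtain e where e: "\<And>x. e x > 0" "\<And>x. emeasure \<mu> (ball x (e x) - {x}) = 0"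
  proof -
    have "\<forall>x. \<exists>e>0. emeasure \<mu> (ball x e - {x}) = 0"
      using counting_config_isolated[OF \<mu>] by metis
    then show thesis using that by metis
  qed
  obtain F where F: "finite F" "{-r..r} \<subseteq> (\<Union>x\<in>F. ball x (e x))"
    using compactE_image[of "{-r..r}" "{-r..r}" "\<lambda>x. ball x (e x)"] e(1)
    by (metis (no_types, lifting) UN_iff centre_in_ball compact_Icc open_ball subsetI)
  have "(\<Union>x\<in>F. ball x (e x) - {x}) \<in> null_sets \<mu>"
    using F(1) e(2) by (intro null_sets.finite_UN null_setsI) (auto simp: sets_counting_configs[OF \<mu>])
  moreover have "{-r..r} - F \<in> sets \<mu>"
    using F(1) by (simp add: sets_counting_configs[OF \<mu>] sets.Diff borel_closed finite_imp_closed)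
  moreover have "{-r..r} - F \<subseteq> (\<Union>x\<in>F. ball x (e x) - {x})"
    using F(2) by auto
  ultimately have "{-r..r} - F \<in> null_sets \<mu>"
    by (rule null_sets_subset)
  then show thesis
    using F(1) by (intro that) auto
qed

text \<open>The product runs over an index set that varies with \<mu>; the exponential form replaces
  it by an integral, which depends measurably on \<mu>. On the bounded support of \<open>q\<close>
  the configuration is a finite sum of atoms, so the integral is a finite sum. The range of
  \<open>q\<close> makes \<open>- ln (1 + q x)\<close> well defined and nonnegative.\<close>

lemma point_prod_eq_exp:
  assumes \<mu>: "\<mu> \<in> counting_configs" and q [measurable]: "q \<in> borel_measurable borel"
    and q_range: "\<And>x. -1 < q x" "\<And>x. q x \<le> 0" and supp: "bounded {x. q x \<noteq> 0}"
  shows "point_prod \<mu> q = exp (- enn2real (\<integral>\<^sup>+x. ennreal (- ln (1 + q x)) \<partial>\<mu>))"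
proof -
  note [measurable_cong, simp] = sets_counting_configs[OF \<mu>]
  define S where "S = {x. measure \<mu> {x} \<noteq> 0 \<and> q x \<noteq> 0}"
  obtain r where r: "\<And>x. q x \<noteq> 0 \<Longrightarrow> \<bar>x\<bar> \<le> r"
    using supp by (auto simp: bounded_real)
  obtain F where F: "finite F" "emeasure \<mu> ({-r..r} - F) = 0"
    using counting_config_atomic[OF \<mu>] by blast
  have mult: "\<exists>k::nat. emeasure \<mu> {x} = of_nat k" for x
    using \<mu> by (auto simp: counting_configs_def)
  \<comment> \<open>An atom in the support of \<open>q\<close> but outside \<open>F\<close> would be
    a point of positive mass in a null set.\<close>
  have "S \<subseteq> F"
  proof
    fix x assume x: "x \<in> S"
    show "x \<in> F"
    proof (rule ccontr)
      assume "x \<notin> F"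
      with x r[of x] have "{x} \<subseteq> {-r..r} - F" by (auto simp: S_def)
      moreover have "{-r..r} - F \<in> sets \<mu>"
        using F(1) by (simp add: sets.Diff borel_closed finite_imp_closed)
      ultimately have "emeasure \<mu> {x} \<le> 0"
        using F(2) emeasure_mono by metis
      with x show False by (simp add: S_def measure_def)
    qed
  qed
  with F have "finite S" by (auto intro: finite_subset)
  define h where "h x = ennreal (- ln (1 + q x))" for x
  have ln_nonpos: "ln (1 + q x) \<le> 0" for x
    using q_range[of x] by simp
  have "(\<integral>\<^sup>+x. h x \<partial>\<mu>) = (\<integral>\<^sup>+x. h x * indicator S x \<partial>\<mu>)"
  proof (rule nn_integral_cong_AE, rule AE_I')
    \<comment> \<open>The integrands can differ only at points of the interval outside
      \<open>F\<close> and at points of \<open>F\<close> that carry no mass; \<open>Z\<close>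
      collects the latter.\<close>
    define Z where "Z = {x\<in>F. emeasure \<mu> {x} = 0}"
    have "finite Z" using F by (simp add: Z_def)
    then have "(\<Union>x\<in>Z. {x}) \<in> null_sets \<mu>"
      by (intro null_sets.finite_UN null_setsI) (auto simp: Z_def)
    moreover have "{-r..r} - F \<in> null_sets \<mu>"
      using F by (intro null_setsI) (simp_all add: sets.Diff borel_closed finite_imp_closed)
    ultimately show "({-r..r} - F) \<union> (\<Union>x\<in>Z. {x}) \<in> null_sets \<mu>" by blast
    show "{x \<in> space \<mu>. h x \<noteq> h x * indicator S x} \<subseteq> ({-r..r} - F) \<union> (\<Union>x\<in>Z. {x})"
    proof
      fix x assume "x \<in> {x \<in> space \<mu>. h x \<noteq> h x * indicator S x}"
      then have x: "h x \<noteq> 0" "x \<notin> S" by (auto simp: indicator_def split: if_splits)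
      then have "q x \<noteq> 0" by (auto simp: h_def)
      with x have "measure \<mu> {x} = 0" by (auto simp: S_def)
      \<comment> \<open>The value of \<open>measure\<close> is 0 on sets of infinite mass as well;
        finite multiplicity excludes this case.\<close>
      then have "emeasure \<mu> {x} = 0"
        using mult[of x] by (auto simp: measure_def)
      then show "x \<in> ({-r..r} - F) \<union> (\<Union>x\<in>Z. {x})"
        using r[OF \<open>q x \<noteq> 0\<close>] by (auto simp: Z_def)
    qed
  qed
  also have "\<dots> = (\<Sum>x\<in>S. h x * emeasure \<mu> {x})"
    using \<open>finite S\<close> by (intro nn_integral_indicator_finite) auto
  also have "\<dots> = (\<Sum>x\<in>S. ennreal (- ln (1 + q x) * measure \<mu> {x}))"
  proof (rule sum.cong)
    fix x
    have "emeasure \<mu> {x} = ennreal (measure \<mu> {x})"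
      using mult[of x] by (intro emeasure_eq_ennreal_measure) auto
    moreover have "0 \<le> - ln (1 + q x)"
      using ln_nonpos[of x] by simp
    ultimately show "h x * emeasure \<mu> {x} = ennreal (- ln (1 + q x) * measure \<mu> {x})"
      unfolding h_def by (simp only: ennreal_mult'[symmetric])
  qed simp
  also have "\<dots> = ennreal (\<Sum>x\<in>S. - ln (1 + q x) * measure \<mu> {x})"
    using ln_nonpos by (intro sum_ennreal mult_nonneg_nonneg) auto
  finally have "enn2real (\<integral>\<^sup>+x. h x \<partial>\<mu>) = (\<Sum>x\<in>S. - ln (1 + q x) * measure \<mu> {x})"
    using ln_nonpos by (simp add: mult_nonpos_nonneg sum_nonpos sum_negf)
  then have "exp (- enn2real (\<integral>\<^sup>+x. h x \<partial>\<mu>)) = (\<Prod>x\<in>S. exp (ln (1 + q x) * measure \<mu> {x}))"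
    using \<open>finite S\<close> by (simp add: sum_negf exp_sum)
  also have "\<dots> = (\<Prod>x\<in>S. (1 + q x) ^ nat \<lfloor>measure \<mu> {x}\<rfloor>)"
  proof (rule prod.cong)
    fix x
    obtain k :: nat where "emeasure \<mu> {x} = of_nat k"
      using mult by blast
    \<comment> \<open>Since the mass is an integer, the floor in \<open>point_prod\<close> returns
      exactly the multiplicity \<open>k\<close>.\<close>
    then have "measure \<mu> {x} = real k" by (simp add: measure_def)
    then show "exp (ln (1 + q x) * measure \<mu> {x}) = (1 + q x) ^ nat \<lfloor>measure \<mu> {x}\<rfloor>"
      using q_range(1)[of x] by (simp add: mult.commute exp_of_nat_mult)
  qed simp
  finally show ?thesis
    by (simp add: point_prod_def S_def h_def)
qed

text \<open>Read off from the exponential form; this permits moving the integral in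
  \<open>G_fac\<close> to the law of the process.\<close>

lemma measurable_point_prod:
  assumes [measurable]: "q \<in> borel_measurable borel"
    and "\<And>x. -1 < q x" "\<And>x. q x \<le> 0" "bounded {x. q x \<noteq> 0}"
  shows "(\<lambda>\<mu>. point_prod \<mu> q) \<in> borel_measurable config_algebra"
proof -
  have [measurable]: "(\<lambda>\<mu>. \<integral>\<^sup>+x. ennreal (- ln (1 + q x)) \<partial>\<mu>) \<in> borel_measurable config_algebra"
    by (rule nn_integral_measurable_config_algebra) simp
  have "(\<lambda>\<mu>. exp (- enn2real (\<integral>\<^sup>+x. ennreal (- ln (1 + q x)) \<partial>\<mu>)))
      \<in> borel_measurable config_algebra"
    by measurable
  then show ?thesis
    by (subst measurable_cong[OF point_prod_eq_exp]) (use assms in auto)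
qed

section \<open>Reflection symmetry of the generating functional\<close>

lemma point_prod_reflect:
  assumes "\<mu> \<in> counting_configs"
  shows "point_prod (reflect \<mu>) q = point_prod \<mu> (\<lambda>x. q (- x))"
proof -
  have "measure (reflect \<mu>) {x} = measure \<mu> {- x}" for x
  proof -
    have "uminus -` {x} = {- x}" by auto
    then show ?thesis using assms by (simp add: measure_def emeasure_reflect sets_counting_configs)
  qed
  then show ?thesis
    unfolding point_prod_def
    by (intro prod.reindex_bij_witness[of _ uminus uminus]) auto
qed

text \<open>\<open>G_fac M N q\<close> is the integral of the point product against the law of the
  process, and reflecting a configuration has the same effect on the point product as reflecting
  \<open>q\<close>.\<close>

lemma G_fac_reversible:
  assumes pp: "point_process M N" and rev: "reversible M N"
    and q: "q \<in> borel_measurable borel" "\<And>x. -1 < q x" "\<And>x. q x \<le> 0" "bounded {x. q x \<noteq> 0}"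
  shows "G_fac M N (\<lambda>x. q (- x)) = G_fac M N q"
proof -
  have N [measurable]: "N \<in> measurable M config_algebra"
    using pp by (simp add: point_process_def)
  have RN [measurable]: "(\<lambda>w. reflect (N w)) \<in> measurable M config_algebra"
    by (rule measurable_compose[OF N measurable_reflect])
  have [measurable]: "(\<lambda>\<mu>. point_prod \<mu> q) \<in> borel_measurable config_algebra"
    by (rule measurable_point_prod) fact+
  have "G_fac M N q = (\<integral>\<^sup>+\<mu>. ennreal (point_prod \<mu> q) \<partial>law M N)"
    by (simp add: G_fac_def law_def nn_integral_distr)
  also have "law M N = law M (\<lambda>w. reflect (N w))"
    using rev by (simp add: reversible_def)
  also have "(\<integral>\<^sup>+\<mu>. ennreal (point_prod \<mu> q) \<partial>\<dots>) = (\<integral>\<^sup>+w. ennreal (point_prod (reflect (N w)) q) \<partial>M)"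
    by (simp add: law_def nn_integral_distr)
  also have "\<dots> = G_fac M N (\<lambda>x. q (- x))"
    unfolding G_fac_def
    using measurable_space[OF N] by (intro nn_integral_cong) (simp add: point_prod_reflect)
  finally show ?thesis ..
qed

section \<open>Mixed derivatives and symmetry of the cumulant measure on products\<close>

text \<open>The intermediate derivatives \<Psi> are determined only on a small cube below the
  origin. Comparing two functions that agree merely on such a cube is therefore the form that
  survives the induction: equal difference quotients have equal left limits, and the cube shrinks at
  each stage.\<close>

lemma has_mixed_deriv_unique:
  assumes "\<delta> > 0" "\<And>s. (\<forall>i<n. s i \<in> {-\<delta><..0}) \<Longrightarrow> \<Phi> s = \<Phi>' s"
    and "has_mixed_deriv n \<Phi> D" "has_mixed_deriv n \<Phi>' D'"
  shows "D = D'"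
  using assms
proof (induction n arbitrary: \<Phi> \<Phi>' \<delta>)
  case (Suc n)
  obtain \<Psi> \<epsilon> where \<Psi>: "has_mixed_deriv n \<Psi> D" "\<epsilon> > 0"
    "\<And>s. (\<forall>i<n. s i \<in> {-\<epsilon><..0}) \<Longrightarrow>
      ((\<lambda>x. \<Phi> (s(n := x))) has_real_derivative \<Psi> s) (at_left 0)"
    using Suc.prems(3) by auto
  obtain \<Psi>' \<epsilon>' where \<Psi>': "has_mixed_deriv n \<Psi>' D'" "\<epsilon>' > 0"
    "\<And>s. (\<forall>i<n. s i \<in> {-\<epsilon>'<..0}) \<Longrightarrow>
      ((\<lambda>x. \<Phi>' (s(n := x))) has_real_derivative \<Psi>' s) (at_left 0)"
    using Suc.prems(4) by auto
  define \<eta> where "\<eta> = min \<delta> (min \<epsilon> \<epsilon>')"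
  have \<eta>: "\<eta> > 0" "\<eta> \<le> \<delta>" "\<eta> \<le> \<epsilon>" "\<eta> \<le> \<epsilon>'"
    using Suc.prems(1) \<Psi>(2) \<Psi>'(2) by (auto simp: \<eta>_def)
  have "\<Psi> s = \<Psi>' s" if s: "\<forall>i<n. s i \<in> {-\<eta><..0}" for s
  proof -
    \<comment> \<open>The interval includes 0 because the difference quotient also involves the
      value at \<open>s(n := 0)\<close>.\<close>
    have eq: "\<Phi> (s(n := x)) = \<Phi>' (s(n := x))" if "x \<in> {-\<delta><..0}" for x
      using that s \<eta> by (intro Suc.prems(2)) (force simp: less_Suc_eq)
    have "((\<lambda>x. \<Phi>' (s(n := x))) has_real_derivative \<Psi> s) (at_left 0)"
      unfolding has_field_derivative_iff
    proof (rule Lim_transform_eventually)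
      show "((\<lambda>x. (\<Phi> (s(n := x)) - \<Phi> (s(n := 0))) / (x - 0)) \<longlongrightarrow> \<Psi> s) (at_left 0)"
        using \<Psi>(3)[of s] s \<eta> by (force simp: has_field_derivative_iff)
      have "\<forall>\<^sub>F x in at_left 0. x \<in> {-\<delta><..<0}"
        using Suc.prems(1) by (intro eventually_at_left_real) simp
      then show "\<forall>\<^sub>F x in at_left 0. (\<Phi> (s(n := x)) - \<Phi> (s(n := 0))) / (x - 0) =
          (\<Phi>' (s(n := x)) - \<Phi>' (s(n := 0))) / (x - 0)"
        by (rule eventually_mono) (use eq Suc.prems(1) in auto)
    qed
    moreover have "((\<lambda>x. \<Phi>' (s(n := x))) has_real_derivative \<Psi>' s) (at_left 0)"
      using s \<eta> by (intro \<Psi>'(3)) force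
    ultimately show ?thesis
      by (auto simp: has_field_derivative_iff intro: tendsto_unique[rotated])
  qed
  then show ?case
    using Suc.IH[OF \<eta>(1) _ \<Psi>(1) \<Psi>'(1)] by blast
qed simp

text \<open>Both sides are mixed derivatives at the origin, one along the \<open>f j\<close> and one
  along their reflections. By \<open>G_fac_reversible\<close> the differentiated functions agree on
  a cube below the origin, so uniqueness of mixed derivatives applies.\<close>

lemma factorial_cumulant_measure_reversible:
  assumes pp: "point_process M N" and rev: "reversible M N"
    and \<kappa>: "factorial_cumulant_measure M N n \<kappa>"
    and f: "\<forall>j<n. test_function (f j) \<and> (\<forall>x. 0 \<le> f j x)"
  shows "signed_integral \<kappa> (\<lambda>t. \<Prod>j<n. f j (t j)) = signed_integral \<kappa> (\<lambda>t. \<Prod>j<n. f j (- t j))"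
proof -
  have f_meas: "f j \<in> borel_measurable borel" if "j < n" for j
    using f that by (simp add: test_function_def)
  have "\<forall>j. \<exists>C>0. j < n \<longrightarrow> (\<forall>x. f j x \<le> C)"
  proof
    fix j
    show "\<exists>C>0. j < n \<longrightarrow> (\<forall>x. f j x \<le> C)"
    proof (cases "j < n")
      case True
      then have "bounded (range (f j))" using f by (simp add: test_function_def)
      then obtain C where "C > 0" "\<And>x. \<bar>f j x\<bar> \<le> C" by (auto simp: bounded_pos)
      then show ?thesis by (meson abs_le_D1)
    qed (auto intro: exI[of _ 1])
  qed
  then obtain C where C: "\<And>j. C j > 0" "\<And>j x. j < n \<Longrightarrow> f j x \<le> C j"
    by metis
  \<comment> \<open>With this \<delta> the sum of the \<open>s j * f j x\<close> stays above -1,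
    since \<delta> times the sum of the bounds is below 1. The summand 1 in the denominator makes
    the inequality strict.\<close>
  define \<delta> where "\<delta> = 1 / (1 + (\<Sum>j<n. C j))"
  have C_sum: "(\<Sum>j<n. C j) \<ge> 0"
    using C(1) by (intro sum_nonneg) (simp add: less_imp_le)
  then have "\<delta> > 0" by (simp add: \<delta>_def)
  have supp: "bounded {x. f j x \<noteq> 0}" if "j < n" for j
    using f that by (simp add: test_function_def)
  have K_eq: "K_fac M N (\<lambda>x. \<Sum>j<n. s j * f j (- x)) = K_fac M N (\<lambda>x. \<Sum>j<n. s j * f j x)"
    if s: "\<forall>j<n. s j \<in> {-\<delta><..0}" for s
  proof -
    define q where "q x = (\<Sum>j<n. s j * f j x)" for x
    have "G_fac M N (\<lambda>x. q (- x)) = G_fac M N q"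
    proof (rule G_fac_reversible[OF pp rev])
      show "q \<in> borel_measurable borel"
        unfolding q_def using f_meas by (intro borel_measurable_sum borel_measurable_times) auto
      show "q x \<le> 0" for x
        unfolding q_def using s f by (intro sum_nonpos mult_nonpos_nonneg) auto
      show "-1 < q x" for x
      proof -
        have "(\<Sum>j<n. - \<delta> * C j) \<le> q x"
          unfolding q_def
        proof (rule sum_mono)
          fix j assume "j \<in> {..<n}"
          then have "- s j * f j x \<le> \<delta> * C j"
            using s f C by (intro mult_mono) (auto simp: less_imp_le minus_le_iff)
          then show "- \<delta> * C j \<le> s j * f j x" by simp
        qed
        moreover have "\<delta> * (\<Sum>j<n. C j) < 1"
          using C_sum by (simp add: \<delta>_def field_simps)
        ultimately show ?thesis by (simp add: sum_distrib_left sum_negf)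
      qed
      have "{x. q x \<noteq> 0} \<subseteq> (\<Union>j<n. {x. f j x \<noteq> 0})"
        unfolding q_def using sum.not_neutral_contains_not_neutral by fastforce
      then show "bounded {x. q x \<noteq> 0}"
        by (rule bounded_subset[rotated]) (use supp in auto)
    qed
    then show ?thesis by (simp add: K_fac_def q_def[abs_def])
  qed
  have deriv: "has_mixed_deriv n (\<lambda>s. K_fac M N (\<lambda>x. \<Sum>j<n. s j * f j x))
      (signed_integral \<kappa> (\<lambda>t. \<Prod>j<n. f j (t j)))"
    using \<kappa> f by (simp add: factorial_cumulant_measure_def)
  have "test_function (\<lambda>x. f j (- x))" if "j < n" for j
  proof -
    have "bounded (range (\<lambda>x. f j (- x)))"
      using f that by (auto simp: test_function_def elim!: bounded_subset)
    moreover have "{x. f j (- x) \<noteq> 0} = uminus ` {x. f j x \<noteq> 0}"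
      by (simp add: uminus_image_eq_vimage vimage_def)
    ultimately show ?thesis
      using f_meas[OF that] supp[OF that] by (simp add: test_function_def)
  qed
  then have deriv_reflect: "has_mixed_deriv n (\<lambda>s. K_fac M N (\<lambda>x. \<Sum>j<n. s j * f j (- x)))
      (signed_integral \<kappa> (\<lambda>t. \<Prod>j<n. f j (- t j)))"
    using \<kappa> f unfolding factorial_cumulant_measure_def
    by (elim conjE allE[of _ "\<lambda>j x. f j (- x)"]) simp
  show ?thesis
    using \<open>\<delta> > 0\<close> K_eq[symmetric] deriv deriv_reflect by (rule has_mixed_deriv_unique)
qed

section \<open>From products to bounded measurable sets\<close>

text \<open>The sets on which the two differences agree form a Dynkin system. Complements use
  finiteness and agreement on \<Omega>; disjoint unions use that convergent series may be subtracted
  termwise.\<close>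

lemma measure_diff_eqI:
  assumes fin: "finite_measure P" "finite_measure Q" "finite_measure P'" "finite_measure Q'"
    and sets: "sets P = sigma_sets \<Omega> E" "sets Q = sigma_sets \<Omega> E"
      "sets P' = sigma_sets \<Omega> E" "sets Q' = sigma_sets \<Omega> E"
    and E: "Int_stable E" "E \<subseteq> Pow \<Omega>" "\<Omega> \<in> E"
    and eq: "\<And>X. X \<in> E \<Longrightarrow> measure P X - measure Q X = measure P' X - measure Q' X"
    and X: "X \<in> sigma_sets \<Omega> E"
  shows "measure P X - measure Q X = measure P' X - measure Q' X"
  using E(1,2) X
proof (induction rule: sigma_sets_induct_disjoint)
  case (compl A)
  have \<Omega>: "\<Omega> \<in> sigma_sets \<Omega> E" by (rule sigma_sets_top)
  have "measure \<nu> (\<Omega> - A) = measure \<nu> \<Omega> - measure \<nu> A"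
    if "finite_measure \<nu>" "sets \<nu> = sigma_sets \<Omega> E" for \<nu>
    using that compl \<Omega> sigma_sets_into_sp[OF E(2)]
    by (intro finite_measure.finite_measure_Diff) auto
  with fin sets show ?case
    using compl.IH eq[OF E(3)] by simp
next
  case (union A)
  have sums: "(\<lambda>i. measure \<nu> (A i)) sums measure \<nu> (\<Union>i. A i)"
    if "finite_measure \<nu>" "sets \<nu> = sigma_sets \<Omega> E" for \<nu>
    using that union.hyps by (intro finite_measure.finite_measure_UNION) auto
  have "(\<lambda>i. measure P (A i) - measure Q (A i)) sums (measure P (\<Union>i. A i) - measure Q (\<Union>i. A i))"
    using fin sets by (intro sums_diff sums)
  moreover have "(\<lambda>i. measure P' (A i) - measure Q' (A i)) sums
      (measure P' (\<Union>i. A i) - measure Q' (\<Union>i. A i))"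
    using fin sets by (intro sums_diff sums)
  ultimately show ?case
    using union.IH sums_unique2 by simp
qed (simp_all add: eq)

text \<open>The two parts of \<kappa> may be infinite, so both are first restricted to a symmetric
  box that contains \<open>X\<close>. There \<open>measure_diff_eqI\<close> extends the identity
  from rectangles, whose indicators are products of test functions. The restriction in
  \<open>R\<close> keeps the reflected point extensional, hence in the product space.\<close>

lemma signed_integral_reflect:
  fixes n :: nat and r :: real
  defines "R \<equiv> \<lambda>t. \<lambda>i\<in>{..<n}. - t i :: real"
  assumes \<kappa>: "signed_measure_on {..<n} \<kappa>"
    and sym: "\<And>f. \<forall>j<n. test_function (f j) \<and> (\<forall>x. 0 \<le> f j x) \<Longrightarrow>
      signed_integral \<kappa> (\<lambda>t. \<Prod>j<n. f j (t j)) = signed_integral \<kappa> (\<lambda>t. \<Prod>j<n. f j (- t j))"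
    and X: "X \<in> sets (\<Pi>\<^sub>M i\<in>{..<n}. borel)" "X \<subseteq> (\<Pi>\<^sub>E i\<in>{..<n}. {-r..r})"
  shows "signed_integral \<kappa> (indicator X) = signed_integral \<kappa> (\<lambda>t. indicator X (R t))"
proof -
  define S :: "(nat \<Rightarrow> real) measure" where "S = (\<Pi>\<^sub>M i\<in>{..<n}. borel)"
  define B where "B = (\<Pi>\<^sub>E i\<in>{..<n}. {-r..r})"
  \<comment> \<open>Restricting by a density makes the measures finite while keeping the
    sigma-algebra of the full product space.\<close>
  define \<nu> where "\<nu> \<mu> = density \<mu> (indicator B)" for \<mu> :: "(nat \<Rightarrow> real) measure"
  define \<nu>' where "\<nu>' \<mu> = distr (\<nu> \<mu>) S R" for \<mu>
  have space_S: "space S = (\<Pi>\<^sub>E i\<in>{..<n}. UNIV)"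
    by (simp add: S_def space_PiM)
  have B [measurable]: "B \<in> sets S"
    unfolding S_def B_def by (intro sets_PiM_I_finite) auto
  have R [measurable]: "R \<in> measurable S S"
    unfolding R_def S_def by measurable
  \<comment> \<open>By symmetry of the box, reflection commutes with restriction to it.\<close>
  have R_B: "R t \<in> B \<longleftrightarrow> t \<in> B" if "t \<in> space S" for t
    using that by (auto simp: R_def B_def space_S PiE_iff minus_le_iff le_minus_iff)
  have lf: "locally_finite_on {..<n} (fst \<kappa>)" "locally_finite_on {..<n} (snd \<kappa>)"
    using \<kappa> by (auto simp: signed_measure_on_def)
  have sets_lf: "sets \<mu> = sets S" if "locally_finite_on {..<n} \<mu>" for \<mu>
    using that by (simp add: locally_finite_on_def S_def)
  have fin: "finite_measure (\<nu> \<mu>)" if \<mu>: "locally_finite_on {..<n} \<mu>" for \<mu>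
  proof (rule finite_measureI)
    have "emeasure (\<nu> \<mu>) (space S) = emeasure \<mu> B"
      using sets.sets_into_space[OF B]
      by (simp add: \<nu>_def emeasure_restricted sets_lf[OF \<mu>] Int_absorb2)
    also have "\<dots> < \<infinity>"
      using \<mu> by (simp add: locally_finite_on_def B_def)
    also have "space S = space (\<nu> \<mu>)"
      using sets_eq_imp_space_eq[OF sets_lf[OF \<mu>]] by (simp add: \<nu>_def)
    finally show "emeasure (\<nu> \<mu>) (space (\<nu> \<mu>)) \<noteq> \<infinity>" by simp
  qed
  have fin': "finite_measure (\<nu>' \<mu>)" if \<mu>: "locally_finite_on {..<n} \<mu>" for \<mu>
    unfolding \<nu>'_def
    by (rule finite_measure.finite_measure_distr[OF fin[OF \<mu>]])
       (simp add: \<nu>_def measurable_cong_sets[OF sets_lf[OF \<mu>] refl])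
  have \<nu>_eq: "measure (\<nu> \<mu>) Y = (\<integral>t. indicator (Y \<inter> B) t \<partial>\<mu>)"
    if \<mu>: "locally_finite_on {..<n} \<mu>" and Y: "Y \<in> sets S" for \<mu> Y
  proof -
    have "Y \<inter> B \<inter> space \<mu> = B \<inter> Y"
      using Y sets_eq_imp_space_eq[OF sets_lf[OF \<mu>]] sets.sets_into_space[OF B] by auto
    then show ?thesis
      using Y by (simp add: \<nu>_def measure_def emeasure_restricted sets_lf[OF \<mu>])
  qed
  have \<nu>'_eq: "measure (\<nu>' \<mu>) Y = (\<integral>t. indicator (Y \<inter> B) (R t) \<partial>\<mu>)"
    if \<mu>: "locally_finite_on {..<n} \<mu>" and Y: "Y \<in> sets S" for \<mu> Y
  proof -
    have sp: "space \<mu> = space S"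
      using sets_lf[OF \<mu>] by (rule sets_eq_imp_space_eq)
    have "measure (\<nu>' \<mu>) Y = measure (\<nu> \<mu>) (R -` Y \<inter> space S)"
      using Y unfolding \<nu>'_def
      by (subst measure_distr) (simp_all add: \<nu>_def sp measurable_cong_sets[OF sets_lf[OF \<mu>] refl])
    also have "\<dots> = (\<integral>t. indicator (R -` Y \<inter> space S \<inter> B) t \<partial>\<mu>)"
      using Y by (intro \<nu>_eq \<mu>) simp
    also have "\<dots> = (\<integral>t. indicator (Y \<inter> B) (R t) \<partial>\<mu>)"
      by (intro Bochner_Integration.integral_cong) (auto simp: indicator_def sp R_B)
    finally show ?thesis .
  qed
  let ?E = "{Pi\<^sub>E {..<n} Y | Y. \<forall>i\<in>{..<n}. Y i \<in> sets (borel :: real measure)}"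
  have sets_S: "sets S = sigma_sets (\<Pi>\<^sub>E i\<in>{..<n}. UNIV) ?E"
    unfolding S_def sets_PiM prod_algebra_eq_finite[OF finite_lessThan] by (simp add: Pi_iff)
  have "measure (\<nu> (fst \<kappa>)) X - measure (\<nu> (snd \<kappa>)) X =
      measure (\<nu>' (fst \<kappa>)) X - measure (\<nu>' (snd \<kappa>)) X"
  proof (rule measure_diff_eqI)
    show "Int_stable ?E" by (rule Int_stable_PiE)
    show "?E \<subseteq> Pow (\<Pi>\<^sub>E i\<in>{..<n}. UNIV)" by (auto simp: PiE_iff)
    show "(\<Pi>\<^sub>E i\<in>{..<n}. UNIV) \<in> ?E" by auto
    show "X \<in> sigma_sets (\<Pi>\<^sub>E i\<in>{..<n}. UNIV) ?E"
      using X(1) sets_S by (simp add: S_def)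
    show "sets (\<nu> (fst \<kappa>)) = sigma_sets (\<Pi>\<^sub>E i\<in>{..<n}. UNIV) ?E"
      "sets (\<nu> (snd \<kappa>)) = sigma_sets (\<Pi>\<^sub>E i\<in>{..<n}. UNIV) ?E"
      "sets (\<nu>' (fst \<kappa>)) = sigma_sets (\<Pi>\<^sub>E i\<in>{..<n}. UNIV) ?E"
      "sets (\<nu>' (snd \<kappa>)) = sigma_sets (\<Pi>\<^sub>E i\<in>{..<n}. UNIV) ?E"
      by (simp_all add: \<nu>_def \<nu>'_def sets_lf lf sets_S)
    fix Z assume "Z \<in> ?E"
    then obtain Y where Y: "Z = Pi\<^sub>E {..<n} Y" "\<And>i. i < n \<Longrightarrow> Y i \<in> sets borel" by auto
    have Z: "Z \<in> sets S"
      unfolding Y(1) S_def by (intro sets_PiM_I_finite) (auto intro: Y)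
    \<comment> \<open>Cutting each side of the rectangle to \<open>{-r..r}\<close> gives bounded
      support; the product then becomes the indicator of \<open>Z \<inter> B\<close>.\<close>
    define f where "f j = (indicator (Y j \<inter> {-r..r}) :: real \<Rightarrow> real)" for j
    have "test_function (f j)" if "j < n" for j
      unfolding test_function_def
    proof (intro conjI)
      show "f j \<in> borel_measurable borel"
        using Y(2)[OF that] by (simp add: f_def)
      show "bounded (range (f j))"
        by (auto simp: bounded_iff f_def indicator_def intro!: exI[of _ 1])
      show "bounded {x. f j x \<noteq> 0}"
        by (rule bounded_subset[of "{-r..r}"]) (auto simp: f_def indicator_def)
    qed
    then have f_sym: "signed_integral \<kappa> (\<lambda>t. \<Prod>j<n. f j (t j)) =
        signed_integral \<kappa> (\<lambda>t. \<Prod>j<n. f j (- t j))"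
      by (intro sym) (simp add: f_def)
    have f_prod: "(\<Prod>j<n. f j (t j)) = indicator (Z \<inter> B) t" if "t \<in> space S" for t
      using that by (auto simp: f_def Y(1) B_def indicator_def space_S PiE_iff prod_zero_iff
          intro!: prod.neutral split: if_splits)
    have f_prod': "(\<Prod>j<n. f j (- t j)) = indicator (Z \<inter> B) (R t)" if "t \<in> space S" for t
    proof -
      have "(\<Prod>j<n. f j (- t j)) = (\<Prod>j<n. f j (R t j))"
        by (intro prod.cong) (auto simp: R_def)
      then show ?thesis
        using f_prod measurable_space[OF R that] by simp
    qed
    have "(\<integral>t. (\<Prod>j<n. f j (t j)) \<partial>\<mu>) = measure (\<nu> \<mu>) Z"
      "(\<integral>t. (\<Prod>j<n. f j (- t j)) \<partial>\<mu>) = measure (\<nu>' \<mu>) Z"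
      if \<mu>: "locally_finite_on {..<n} \<mu>" for \<mu>
      unfolding \<nu>_eq[OF \<mu> Z] \<nu>'_eq[OF \<mu> Z] using sets_eq_imp_space_eq[OF sets_lf[OF \<mu>]]
      by (auto simp: f_prod f_prod' simp del: Bochner_Integration.integral_indicator
          intro!: Bochner_Integration.integral_cong)
    with f_sym lf show "measure (\<nu> (fst \<kappa>)) Z - measure (\<nu> (snd \<kappa>)) Z =
        measure (\<nu>' (fst \<kappa>)) Z - measure (\<nu>' (snd \<kappa>)) Z"
      by (simp add: signed_integral_def)
  qed (intro fin fin' lf)+
  \<comment> \<open>\<open>X\<close> lies in the box, so the restricted measures give it its
    original value.\<close>
  moreover have "X \<inter> B = X" "X \<in> sets S"
    using X by (auto simp: B_def S_def)
  ultimately show ?thesis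
    by (simp add: signed_integral_def \<nu>_eq \<nu>'_eq lf)
qed

section \<open>Reflection symmetry of the lag density\<close>

lemma lborel_distr_uminus_euclidean:
  "distr lborel borel uminus = (lborel :: 'a::euclidean_space measure)"
  by (subst lborel_affine[of "-1" 0]) (auto simp: density_1 one_ennreal_def[symmetric])

text \<open>Fixing \<open>t 0\<close> in an interval of length one turns the disintegration over
  lags into the plain integral of \<open>c\<close>. Reflection moves this window from
  \<open>{0..1}\<close> to \<open>{-1..0}\<close>, again of length one, and negates the
  lags.\<close>

lemma lag_density_integral_reflect:
  fixes \<kappa> \<kappa>red :: signed_measure and c :: "real \<times> real \<Rightarrow> real"
  assumes \<kappa>: "signed_measure_on {..<3} \<kappa>"
    and sym: "\<And>f. \<forall>j<3. test_function (f j) \<and> (\<forall>x. 0 \<le> f j x) \<Longrightarrow>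
      signed_integral \<kappa> (\<lambda>t. \<Prod>j<3. f j (t j)) = signed_integral \<kappa> (\<lambda>t. \<Prod>j<3. f j (- t j))"
    and red: "reduced_measure 3 \<kappa> \<kappa>red" and dens: "has_lag_density \<kappa>red c"
    and A: "A \<in> sets borel" "bounded A"
  shows "(LINT p:A|lborel. c p) = (LINT p:uminus ` A|lborel. c p)"
proof -
  define S :: "(nat \<Rightarrow> real) measure" where "S = (\<Pi>\<^sub>M i\<in>{..<3}. borel)"
  define R where "R t = (\<lambda>i\<in>{..<3::nat}. - t i :: real)" for t
  \<comment> \<open>\<open>U\<close> is the set to be reflected; \<open>F\<close> and
    \<open>F'\<close> are the product forms of the indicators of \<open>U\<close> and of its
    reflection, suited to the disintegration.\<close>
  define U where "U = {t \<in> space S. t 0 \<in> {0..1} \<and> (t 1 - t 0, t 2 - t 0) \<in> A}"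
  define F :: "(nat \<Rightarrow> real) \<Rightarrow> real"
    where "F t = indicator {0..1} (t 0) * indicator A (t 1 - t 0, t 2 - t 0)" for t
  define F' :: "(nat \<Rightarrow> real) \<Rightarrow> real"
    where "F' t = indicator {-1..0} (t 0) * indicator (uminus ` A) (t 1 - t 0, t 2 - t 0)" for t
  have A': "uminus ` A \<in> sets borel" "bounded (uminus ` A)"
    using measurable_sets_borel[of uminus borel A] A by (simp_all add: uminus_image_eq_vimage[symmetric])
  obtain r where r: "\<And>p. p \<in> A \<Longrightarrow> norm p \<le> r" "r > 0"
    using A(2) by (auto simp: bounded_pos)
  have coord_le: "\<bar>x\<bar> \<le> r" "\<bar>y\<bar> \<le> r" if "norm (x, y) \<le> r" for x y :: real
    using that norm_fst_le[of x y] norm_snd_le[of y x] by auto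
  note rA = coord_le[OF r(1)]
  have comp: "(\<lambda>t. t i) \<in> borel_measurable S" if "i < 3" for i
    unfolding S_def using that by (intro measurable_component_singleton) simp
  note [measurable] = comp[of 0] comp[of 1] comp[of 2]
  have three: "(\<forall>i\<in>{..<3}. P i) \<longleftrightarrow> P 0 \<and> P 1 \<and> P 2" for P :: "nat \<Rightarrow> bool"
    by (auto simp: less_Suc_eq numeral_3_eq_3 numeral_2_eq_2)
  have test: "test_function_on {..<3} (\<lambda>t. indicator I (t 0) * indicator D (t 1 - t 0, t 2 - t 0))"
    if [measurable]: "I \<in> sets borel" "D \<in> sets borel"
      and I: "I \<subseteq> {-1..1}" and D: "\<And>p. p \<in> D \<Longrightarrow> norm p \<le> r"
    for I :: "real set" and D :: "(real \<times> real) set"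
    unfolding test_function_on_def S_def[symmetric]
  proof (intro conjI exI ballI)
    fix t :: "nat \<Rightarrow> real"
    show "\<bar>indicator I (t 0) * indicator D (t 1 - t 0, t 2 - t 0)\<bar> \<le> (1::real)"
      by (simp add: indicator_def)
    show "indicator I (t 0) * indicator D (t 1 - t 0, t 2 - t 0) \<noteq> (0::real) \<longrightarrow>
        (\<forall>i\<in>{..<3}. \<bar>t i\<bar> \<le> 1 + r)"
    proof
      assume "indicator I (t 0) * indicator D (t 1 - t 0, t 2 - t 0) \<noteq> (0::real)"
      then have t: "t 0 \<in> I" "(t 1 - t 0, t 2 - t 0) \<in> D"
        by (auto simp: indicator_def split: if_splits)
      then have "\<bar>t 0\<bar> \<le> 1" "\<bar>t 1 - t 0\<bar> \<le> r" "\<bar>t 2 - t 0\<bar> \<le> r"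
        using subsetD[OF I t(1)] coord_le[OF D[OF t(2)]] by auto
      then show "\<forall>i\<in>{..<3}. \<bar>t i\<bar> \<le> 1 + r"
        unfolding three using r(2) by linarith
    qed
  qed measurable
  \<comment> \<open>Along \<open>from_lags\<close> the differences recover the lags, so the
    integrand splits into \<open>indicator I t\<close> and a function of the lags alone. Integrating
    over \<open>t\<close> then leaves the length of \<open>I\<close>.\<close>
  have lags: "signed_integral \<kappa> (\<lambda>t. indicator I (t 0) * indicator D (t 1 - t 0, t 2 - t 0)) =
      measure lborel I * (LINT p:D|lborel. c p)"
    if "test_function_on {..<3} (\<lambda>t. indicator I (t 0) * indicator D (t 1 - t 0, t 2 - t 0))"
      and "D \<in> sets borel" "bounded D" for I D
  proof -
    have "signed_integral \<kappa>red (\<lambda>\<tau>. indicator I t * indicator D (\<tau> 1, \<tau> 2)) =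
        indicator I t * (LINT p:D|lborel. c p)" for t
      using dens that by (simp add: has_lag_density_def signed_integral_def right_diff_distrib[symmetric])
    then show ?thesis
      using red that by (simp add: reduced_measure_def from_lags_def)
  qed
  have sp: "space (fst \<kappa>) = space S" "space (snd \<kappa>) = space S"
    using \<kappa> by (auto simp: signed_measure_on_def locally_finite_on_def S_def
        intro!: sets_eq_imp_space_eq)
  have signed_cong: "signed_integral \<kappa> G = signed_integral \<kappa> H"
    if "\<And>t. t \<in> space S \<Longrightarrow> G t = H t" for G H
    unfolding signed_integral_def using that
    by (intro arg_cong2[where f = minus] Bochner_Integration.integral_cong) (auto simp: sp)
  have "signed_integral \<kappa> (indicator U) = signed_integral \<kappa> (\<lambda>t. indicator U (R t))"
    unfolding R_def
  \<comment> \<open>The half-width \<open>1 + r\<close> adds the bound 1 on \<open>t 0\<close> to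
    the bound \<open>r\<close> on the lags.\<close>
  proof (rule signed_integral_reflect[where r = "1 + r"])
    show "signed_measure_on {..<3} \<kappa>" by fact
    have "U \<in> sets S"
      unfolding U_def using A(1) by measurable
    then show "U \<in> sets (Pi\<^sub>M {..<3} (\<lambda>i. borel))" by (simp add: S_def)
    show "U \<subseteq> (\<Pi>\<^sub>E i\<in>{..<3}. {-(1+r)..1+r})"
    proof
      fix t assume "t \<in> U"
      then have t: "t \<in> extensional {..<3}" "t 0 \<in> {0..1}"
        "\<bar>t 1 - t 0\<bar> \<le> r" "\<bar>t 2 - t 0\<bar> \<le> r"
        using rA[of "t 1 - t 0" "t 2 - t 0"] by (auto simp: U_def S_def space_PiM PiE_iff)
      then show "t \<in> (\<Pi>\<^sub>E i\<in>{..<3}. {-(1+r)..1+r})"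
        unfolding PiE_iff three using r(2) by (simp; linarith)
    qed
  qed (rule sym)
  moreover have "indicator U t = F t" if "t \<in> space S" for t
    using that by (auto simp: U_def F_def indicator_def)
  then have "signed_integral \<kappa> (indicator U) = signed_integral \<kappa> F"
    by (rule signed_cong)
  moreover have "indicator U (R t) = F' t" if "t \<in> space S" for t
  proof -
    have "R t \<in> space S" by (simp add: R_def S_def space_PiM)
    \<comment> \<open>The left-hand pair consists of the lags of the reflected point
      \<open>R t\<close>.\<close>
    moreover have "(t 0 - t 1, t 0 - t 2) \<in> A \<longleftrightarrow> (t 1 - t 0, t 2 - t 0) \<in> uminus ` A"
      by (simp add: uminus_image_eq_vimage)
    ultimately show ?thesis
      by (auto simp: U_def F'_def R_def indicator_def)
  qed
  then have "signed_integral \<kappa> (\<lambda>t. indicator U (R t)) = signed_integral \<kappa> F'"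
    by (rule signed_cong)
  moreover have "signed_integral \<kappa> F = (LINT p:A|lborel. c p)"
    using lags[OF test[of "{0..1}" A]] A r(1) unfolding F_def by simp
  moreover have "signed_integral \<kappa> F' = (LINT p:uminus ` A|lborel. c p)"
  proof -
    have "norm p \<le> r" if "p \<in> uminus ` A" for p
      using that r(1)[of "- p"] by (simp add: uminus_image_eq_vimage)
    then show ?thesis
      using lags[OF test[of "{-1..0}" "uminus ` A"]] A' unfolding F'_def by simp
  qed
  ultimately show ?thesis by simp
qed

text \<open>The integral identity concerns bounded sets, so \<open>c\<close> and its reflection are
  compared on balls of radius \<open>n\<close>, where equal integrals over all measurable sets force
  almost everywhere equality. Countably many balls exhaust the space.\<close>

lemma AE_reflect_if_integral_reflect:
  fixes c :: "'a::euclidean_space \<Rightarrow> real"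
  assumes c: "integrable lborel c"
    and sym: "\<And>A. A \<in> sets borel \<Longrightarrow> bounded A \<Longrightarrow>
      (LINT p:A|lborel. c p) = (LINT p:uminus ` A|lborel. c p)"
  shows "AE p in lborel. c p = c (- p)"
proof -
  have [measurable]: "c \<in> borel_measurable borel" using c by simp
  have c': "integrable lborel (\<lambda>p. c (- p))"
    using c integrable_distr[of uminus lborel borel c] by (simp add: lborel_distr_uminus_euclidean)
  have "AE p in lborel. indicator (ball 0 (real n)) p * c p = indicator (ball 0 (real n)) p * c (- p)"
    for n
  proof (rule density_unique_real)
    show "integrable lborel (\<lambda>p. indicator (ball 0 (real n)) p * c p)"
      "integrable lborel (\<lambda>p. indicator (ball 0 (real n)) p * c (- p))"
      using c c' by (auto intro!: integrable_real_mult_indicator simp: mult.commute[of "indicator _ _"])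
    fix A :: "'a set" assume "A \<in> sets lborel"
    then have A: "A \<inter> ball 0 (real n) \<in> sets borel" "bounded (A \<inter> ball 0 (real n))"
      by (auto intro: bounded_subset[OF bounded_ball])
    let ?A = "A \<inter> ball 0 (real n)"
    have "(LINT p:A|lborel. indicator (ball 0 (real n)) p * c p) = (LINT p:?A|lborel. c p)"
      unfolding set_lebesgue_integral_def
      by (intro Bochner_Integration.integral_cong) (auto simp: indicator_def)
    also have "\<dots> = (LINT p:uminus ` ?A|lborel. c p)"
      using A by (rule sym)
    \<comment> \<open>Lebesgue measure is invariant under negation; this change of variables moves
      the reflection from the set to the integrand.\<close>
    also have "\<dots> = (LINT p:uminus ` ?A|distr lborel borel uminus. c p)"
      by (simp add: lborel_distr_uminus_euclidean)
    also have "\<dots> = (\<integral>p. indicator (uminus ` ?A) (- p) *\<^sub>R c (- p) \<partial>lborel)"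
    proof -
      have "uminus ` ?A \<in> sets borel"
        unfolding uminus_image_eq_vimage using measurable_sets_borel[of uminus borel ?A] A(1) by simp
      then show ?thesis
        unfolding set_lebesgue_integral_def by (intro integral_distr) auto
    qed
    also have "\<dots> = (LINT p:A|lborel. indicator (ball 0 (real n)) p * c (- p))"
      unfolding set_lebesgue_integral_def
      by (intro Bochner_Integration.integral_cong) (auto simp: indicator_def uminus_image_eq_vimage)
    finally show "(LINT p:A|lborel. indicator (ball 0 (real n)) p * c p) =
        (LINT p:A|lborel. indicator (ball 0 (real n)) p * c (- p))" .
  qed
  then have "AE p in lborel. \<forall>n. indicator (ball 0 (real n)) p * c p =
      indicator (ball 0 (real n)) p * c (- p)"
    by (subst AE_all_countable) (rule allI)
  then show ?thesis
  proof eventually_elim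
    case (elim p)
    obtain n where "norm p < real n" using reals_Archimedean2 by blast
    with elim[rule_format, of n] show ?case by simp
  qed
qed

section \<open>Reality of the bispectrum\<close>

text \<open>Conjugation replaces \<open>e p\<close> by \<open>e (- p)\<close>. The symmetry of
  \<open>c\<close> and the substitution of \<open>- p\<close> for \<open>p\<close> undo this, so the
  integral equals its own conjugate.\<close>

lemma B_fac_real:
  assumes c: "integrable lborel c" and ae: "AE p in lborel. c p = c (- p)"
  shows "B_fac c \<omega>1 \<omega>2 \<in> \<real>"
proof -
  define e where "e p = exp (- (\<i> * complex_of_real (\<omega>1 * fst p + \<omega>2 * snd p)))" for p :: "real \<times> real"
  have [measurable]: "c \<in> borel_measurable borel" using c by simp
  have [measurable]: "e \<in> borel_measurable borel"
    unfolding e_def by (intro borel_measurable_continuous_onI continuous_intros)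
  have B: "B_fac c \<omega>1 \<omega>2 = (\<integral>p. of_real (c p) * e p \<partial>lborel)"
    by (simp add: B_fac_def e_def case_prod_unfold)
  have "cnj (B_fac c \<omega>1 \<omega>2) = (\<integral>p. of_real (c p) * e (- p) \<partial>lborel)"
  proof -
    have "cnj (e p) = e (- p)" for p
      by (simp add: e_def exp_cnj algebra_simps)
    then show ?thesis
      using Bochner_Integration.integral_cnj[of lborel "\<lambda>p. of_real (c p) * e p", symmetric]
      by (simp only: B complex_cnj_mult complex_cnj_complex_of_real)
  qed
  also have "\<dots> = (\<integral>p. of_real (c (- p)) * e (- p) \<partial>lborel)"
    by (rule integral_cong_AE) (use ae in auto)
  also have "\<dots> = (\<integral>p. of_real (c p) * e p \<partial>distr lborel borel uminus)"
    by (rule integral_distr[symmetric]) auto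
  also have "\<dots> = B_fac c \<omega>1 \<omega>2"
    by (simp add: B lborel_distr_uminus_euclidean)
  finally show ?thesis by (simp add: Reals_cnj_iff)
qed

theorem theorem2p1:
  fixes M :: "'w measure" and N :: "'w \<Rightarrow> real measure"
    and \<kappa>3 \<kappa>3red :: signed_measure
    and c3 :: "real \<times> real \<Rightarrow> real"
  assumes "point_process M N"
    and "stationary M N"
    and "factorial_cumulant_measure M N 3 \<kappa>3"
    and "reduced_measure 3 \<kappa>3 \<kappa>3red"
    and "has_lag_density \<kappa>3red c3"
    and "integrable lborel c3"
    and "reversible M N"
  shows "(AE (\<tau>1, \<tau>2) in lborel. c3 (\<tau>1, \<tau>2) = c3 (- \<tau>1, - \<tau>2)) \<and>
         (\<forall>\<omega>1 \<omega>2. B_fac c3 \<omega>1 \<omega>2 \<in> \<real>)"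
proof -
  have "signed_measure_on {..<3} \<kappa>3"
    using assms(3) by (simp add: factorial_cumulant_measure_def)
  \<comment> \<open>Reversibility enters here, through the symmetry of the third cumulant measure on
    products.\<close>
  then have "(LINT p:A|lborel. c3 p) = (LINT p:uminus ` A|lborel. c3 p)"
    if "A \<in> sets borel" "bounded A" for A
    using factorial_cumulant_measure_reversible[OF assms(1,7,3)] assms(4,5) that
    by (intro lag_density_integral_reflect)
  then have "AE p in lborel. c3 p = c3 (- p)"
    by (intro AE_reflect_if_integral_reflect assms(6))
  then show ?thesis
    using B_fac_real[OF assms(6)] by (auto simp: case_prod_unfold uminus_prod_def)
qed

end
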